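(* Let the system $x_{t+1}=f(x_t,u_t,w_t)$, $y_t=h(x_t,u_t,w_t)$ admit a $\delta$-IOSS Lyapunov function $W_\delta$ with $\alpha_1,\alpha_2\in\mathcal{K}_\infty$, $\sigma_w,\sigma_y\in\mathcal{K}$, $\eta\in[0,1)$ (as defined in the context). Then the full information estimator (FIE) described in the context is a robustly globally asymptotically stable (RGAS) state estimator.
   Context: Notation: $\mathbb{I}_{\ge a}$ is the set of integers $\ge a$, $\mathbb{I}_{[a,b]}$ the integers in $[a,b]$; $\|\cdot\|$ is the Euclidean norm. $\mathcal{K}$: continuous strictly increasing functions $\alpha:\mathbb{R}_{\ge0}\to\mathbb{R}_{\ge0}$ with $\alpha(0)=0$; $\mathcal{K}_\infty$: unbounded functions in $\mathcal{K}$; $\mathcal{L}$: continuous, non-increasing functions $\theta:\mathbb{I}_{\ge0}\to\mathbb{R}_{\ge0}$ with $\lim_{t\to\infty}\theta(t)=0$; $\mathcal{KL}$: functions $\beta:\mathbb{R}_{\ge0}\times\mathbb{I}_{\ge0}\to\mathbb{R}_{\ge0}$ with $\beta(\cdot,t)\in\mathcal{K}$ and $\beta(r,\cdot)\in\mathcal{L}$ for each fixed $t\in\mathbb{I}_{\ge0}$, $r\in\mathbb{R}_{\ge0}$. Convention: $0^0=1$; empty sums are $0$ and maxima over empty sets (of nonnegative quantities) are $0$. System: $x_{t+1}=f(x_t,u_t,w_t)$, $y_t=h(x_t,u_t,w_t)$, $t\in\mathbb{I}_{\ge0}$, with $f:\mathbb{R}^n\times\mathbb{R}^m\times\mathbb{R}^q\to\mathbb{R}^n$,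 $h:\mathbb{R}^n\times\mathbb{R}^m\times\mathbb{R}^q\to\mathbb{R}^p$ continuous. State $x_t$, known input $u_t$, unknown disturbance $w_t$, measured output $y_t$. The true trajectory satisfies $(x_t,u_t,w_t,y_t)\in\mathbb{Z}:=\mathbb{X}\times\mathbb{U}\times\mathbb{W}\times\mathbb{Y}$ for all $t\in\mathbb{I}_{\ge0}$, where $\mathbb{X}\subseteq\mathbb{R}^n$, $\mathbb{U}\subseteq\mathbb{R}^m$, $\mathbb{W}\subseteq\mathbb{R}^q$, $\mathbb{Y}\subseteq\mathbb{R}^p$. An initial guess $\hat x_0\in\mathbb{X}$ of $x_0$ is given. $\delta$-IOSS Lyapunov function: a function $W_\delta:\mathbb{R}^n\times\mathbb{R}^n\to\mathbb{R}_{\ge0}$ for which there exist $\alpha_1,\alpha_2\in\mathcal{K}_\infty$, $\sigma_w,\sigma_y\in\mathcal{K}$, $\eta\in[0,1)$ such that both (a) $\alpha_1(\|x-\tilde x\|)\le W_\delta(x,\tilde x)\le\alpha_2(\|x-\tilde x\|)$ and (b) $W_\delta(f(x,u,w),f(\tilde x,u,\tilde w))\le\eta W_\delta(x,\tilde x)+\sigma_w(\|w-\tilde w\|)+\sigma_y(\|y-\tilde y\|)$ hold for all $(x,u,w,y),(\tilde x,u,\tilde w,\tilde y)\in\mathbb{Z}$, where $y=h(x,u,w)$ and $\tilde y=h(\tilde x,u,\tilde w)$. FIE scheme: at each time $t\in\mathbb{I}_{\ge0}$, given $\hat x_0$ and all past data $u_j,y_j$, $j\in\mathbb{I}_{[0,t-1]}$,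 minimize over $\hat x_{0|t}$ and $\hat w_{\cdot|t}=\{\hat w_{j|t}\}_{j=0}^{t-1}$ the cost $$V_{\mathrm{FIE}}(\hat x_{0|t},\hat w_{\cdot|t},\hat y_{\cdot|t},t)=\eta^t\alpha_2(2\|\hat x_{0|t}-\hat x_0\|)+\sum_{j=1}^{t}\eta^{j-1}\left(\sigma_w(2\|\hat w_{t-j|t}\|)+\sigma_y(\|\hat y_{t-j|t}-y_{t-j}\|)\right)$$ subject to $\hat x_{j+1|t}=f(\hat x_{j|t},u_j,\hat w_{j|t})$, $\hat y_{j|t}=h(\hat x_{j|t},u_j,\hat w_{j|t})$, $\hat w_{j|t}\in\mathbb{W}$, $\hat y_{j|t}\in\mathbb{Y}$ for $j\in\mathbb{I}_{[0,t-1]}$, and $\hat x_{j|t}\in\mathbb{X}$ for $j\in\mathbb{I}_{[0,t]}$, with $\alpha_2,\sigma_w,\sigma_y,\eta$ from the $\delta$-IOSS Lyapunov function. The state trajectory corresponding to a minimizer at time $t$ is denoted by $\hat x^*_{\cdot|t}$; the estimate at time $t$ is $\hat x_t=\hat x^*_{t|t}$ (at $t=0$ this is the initial guess $\hat x_0$). RGAS: a state estimator is robustly globally asymptotically stable if there exist $\beta_1,\beta_2\in\mathcal{KL}$ such that $$\|x_t-\hat x_t\|\le\max\left\{\beta_1(\|x_0-\hat x_0\|,t),\ \max_{j\in\mathbb{I}_{[0,t-1]}}\beta_2(\|w_j\|,t-j-1)\right\}$$ for all $t\in\mathbb{I}_{\ge0}$, all $x_0,\hat x_0\in\mathbb{X}$,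 and every trajectory $(x_t,u_t,w_t,y_t)_{t=0}^\infty$ satisfying the system equations and $(x_t,u_t,w_t,y_t)\in\mathbb{Z}$ for all $t$.
   Formalization: Bound (a) is required for all pairs of states in X (with U, W, Y nonempty), not only for states whose outputs y=h(x,u,w) lie in Y; otherwise the claim fails, since the final FIE state is only constrained to X. *)

theory Defs
  imports "HOL-Analysis.Analysis"
begin

(* Comparison functions on the nonnegative reals are total functions on the reals;
   only their restriction to {0..} is constrained. *)

definition class_K :: "(real \<Rightarrow> real) \<Rightarrow> bool" where
  "class_K \<alpha> \<longleftrightarrow> \<alpha> \<in> {0..} \<rightarrow> {0..} \<and> continuous_on {0..} \<alpha> \<and> strict_mono_on {0..} \<alpha> \<and> \<alpha> 0 = 0"

definition class_K_inf :: "(real \<Rightarrow> real) \<Rightarrow> bool" where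
  "class_K_inf \<alpha> \<longleftrightarrow> class_K \<alpha> \<and> \<not> bdd_above (\<alpha> ` {0..})"

definition class_L :: "(nat \<Rightarrow> real) \<Rightarrow> bool" where
  "class_L \<theta> \<longleftrightarrow> (\<forall>t. 0 \<le> \<theta> t) \<and> continuous_on UNIV \<theta> \<and> antimono \<theta> \<and> \<theta> \<longlonglongrightarrow> 0"

definition class_KL :: "(real \<Rightarrow> nat \<Rightarrow> real) \<Rightarrow> bool" where
  "class_KL \<beta> \<longleftrightarrow> (\<forall>t. class_K (\<lambda>r. \<beta> r t)) \<and> (\<forall>r\<ge>0. class_L (\<beta> r))"

definition admissible_trajectory ::
  "(real^'n \<Rightarrow> real^'m \<Rightarrow> real^'q \<Rightarrow> real^'n) \<Rightarrow> (real^'n \<Rightarrow> real^'m \<Rightarrow> real^'q \<Rightarrow> real^'p) \<Rightarrow>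
   (real^'n) set \<Rightarrow> (real^'m) set \<Rightarrow> (real^'q) set \<Rightarrow> (real^'p) set \<Rightarrow>
   (nat \<Rightarrow> real^'n) \<Rightarrow> (nat \<Rightarrow> real^'m) \<Rightarrow> (nat \<Rightarrow> real^'q) \<Rightarrow> (nat \<Rightarrow> real^'p) \<Rightarrow> bool" where
  "admissible_trajectory f h X U W Y x u w y \<longleftrightarrow>
     (\<forall>t. x (Suc t) = f (x t) (u t) (w t) \<and> y t = h (x t) (u t) (w t) \<and>
          (x t, u t, w t, y t) \<in> X \<times> U \<times> W \<times> Y)"

(* All four components of both tuples range over the product set X \<times> U \<times> W \<times> Y.
   The outputs occur only in the dissipation inequality, and only there are they tied
   to h.  The two-sided bound is thus required on all of X \<times> X (when U, W, Y are
   nonempty), in particular at states from which no output in Y is possible. *)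
definition delta_IOSS_Lyapunov ::
  "(real^'n \<Rightarrow> real^'m \<Rightarrow> real^'q \<Rightarrow> real^'n) \<Rightarrow> (real^'n \<Rightarrow> real^'m \<Rightarrow> real^'q \<Rightarrow> real^'p) \<Rightarrow>
   (real^'n) set \<Rightarrow> (real^'m) set \<Rightarrow> (real^'q) set \<Rightarrow> (real^'p) set \<Rightarrow>
   (real^'n \<Rightarrow> real^'n \<Rightarrow> real) \<Rightarrow> (real \<Rightarrow> real) \<Rightarrow> (real \<Rightarrow> real) \<Rightarrow>
   (real \<Rightarrow> real) \<Rightarrow> (real \<Rightarrow> real) \<Rightarrow> real \<Rightarrow> bool" where
  "delta_IOSS_Lyapunov f h X U W Y V \<alpha>1 \<alpha>2 \<sigma>w \<sigma>y \<eta> \<longleftrightarrow>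
     (\<forall>x x'. 0 \<le> V x x') \<and>
     class_K_inf \<alpha>1 \<and> class_K_inf \<alpha>2 \<and> class_K \<sigma>w \<and> class_K \<sigma>y \<and> 0 \<le> \<eta> \<and> \<eta> < 1 \<and>
     (\<forall>x x' u w w' y y'.
        (x, u, w, y) \<in> X \<times> U \<times> W \<times> Y \<and> (x', u, w', y') \<in> X \<times> U \<times> W \<times> Y \<longrightarrow>
        \<alpha>1 (norm (x - x')) \<le> V x x' \<and> V x x' \<le> \<alpha>2 (norm (x - x')) \<and>
        (y = h x u w \<and> y' = h x' u w' \<longrightarrow>
           V (f x u w) (f x' u w') \<le> \<eta> * V x x' + \<sigma>w (norm (w - w')) + \<sigma>y (norm (y - y'))))"

primrec state_traj ::
  "(real^'n \<Rightarrow> real^'m \<Rightarrow> real^'q \<Rightarrow> real^'n) \<Rightarrow> (nat \<Rightarrow> real^'m) \<Rightarrow>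
   real^'n \<Rightarrow> (nat \<Rightarrow> real^'q) \<Rightarrow> nat \<Rightarrow> real^'n" where
  "state_traj f u x0 w 0 = x0"
| "state_traj f u x0 w (Suc j) = f (state_traj f u x0 w j) (u j) (w j)"

definition output_traj ::
  "(real^'n \<Rightarrow> real^'m \<Rightarrow> real^'q \<Rightarrow> real^'n) \<Rightarrow> (real^'n \<Rightarrow> real^'m \<Rightarrow> real^'q \<Rightarrow> real^'p) \<Rightarrow>
   (nat \<Rightarrow> real^'m) \<Rightarrow> real^'n \<Rightarrow> (nat \<Rightarrow> real^'q) \<Rightarrow> nat \<Rightarrow> real^'p" where
  "output_traj f h u x0 w j = h (state_traj f u x0 w j) (u j) (w j)"

(* In the estimation problem at time t, xi and omega are the decision variables
   (initial state and disturbances); only omega 0, ..., omega (t - 1) matter. *)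

definition fie_cost ::
  "(real \<Rightarrow> real) \<Rightarrow> (real \<Rightarrow> real) \<Rightarrow> (real \<Rightarrow> real) \<Rightarrow> real \<Rightarrow> real^'n \<Rightarrow> (nat \<Rightarrow> real^'p) \<Rightarrow>
   real^'n \<Rightarrow> (nat \<Rightarrow> real^'q) \<Rightarrow> (nat \<Rightarrow> real^'p) \<Rightarrow> nat \<Rightarrow> real" where
  "fie_cost \<alpha>2 \<sigma>w \<sigma>y \<eta> xhat0 y \<xi> \<omega> \<upsilon> t =
     \<eta> ^ t * \<alpha>2 (2 * norm (\<xi> - xhat0)) +
     (\<Sum>j=1..t. \<eta> ^ (j - 1) *
        (\<sigma>w (2 * norm (\<omega> (t - j))) + \<sigma>y (norm (\<upsilon> (t - j) - y (t - j)))))"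

definition fie_feasible ::
  "(real^'n \<Rightarrow> real^'m \<Rightarrow> real^'q \<Rightarrow> real^'n) \<Rightarrow> (real^'n \<Rightarrow> real^'m \<Rightarrow> real^'q \<Rightarrow> real^'p) \<Rightarrow>
   (real^'n) set \<Rightarrow> (real^'q) set \<Rightarrow> (real^'p) set \<Rightarrow> (nat \<Rightarrow> real^'m) \<Rightarrow> nat \<Rightarrow>
   real^'n \<Rightarrow> (nat \<Rightarrow> real^'q) \<Rightarrow> bool" where
  "fie_feasible f h X W Y u t \<xi> \<omega> \<longleftrightarrow>
     (\<forall>j<t. \<omega> j \<in> W \<and> output_traj f h u \<xi> \<omega> j \<in> Y) \<and> (\<forall>j\<le>t. state_traj f u \<xi> \<omega> j \<in> X)"

definition fie_minimizer ::
  "(real^'n \<Rightarrow> real^'m \<Rightarrow> real^'q \<Rightarrow> real^'n) \<Rightarrow> (real^'n \<Rightarrow> real^'m \<Rightarrow> real^'q \<Rightarrow> real^'p) \<Rightarrow>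
   (real^'n) set \<Rightarrow> (real^'q) set \<Rightarrow> (real^'p) set \<Rightarrow>
   (real \<Rightarrow> real) \<Rightarrow> (real \<Rightarrow> real) \<Rightarrow> (real \<Rightarrow> real) \<Rightarrow> real \<Rightarrow>
   nat \<Rightarrow> real^'n \<Rightarrow> (nat \<Rightarrow> real^'m) \<Rightarrow> (nat \<Rightarrow> real^'p) \<Rightarrow>
   real^'n \<Rightarrow> (nat \<Rightarrow> real^'q) \<Rightarrow> bool" where
  "fie_minimizer f h X W Y \<alpha>2 \<sigma>w \<sigma>y \<eta> t xhat0 u y \<xi> \<omega> \<longleftrightarrow>
     fie_feasible f h X W Y u t \<xi> \<omega> \<and>
     (\<forall>\<xi>' \<omega>'. fie_feasible f h X W Y u t \<xi>' \<omega>' \<longrightarrow>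
        fie_cost \<alpha>2 \<sigma>w \<sigma>y \<eta> xhat0 y \<xi> \<omega> (output_traj f h u \<xi> \<omega>) t
        \<le> fie_cost \<alpha>2 \<sigma>w \<sigma>y \<eta> xhat0 y \<xi>' \<omega>' (output_traj f h u \<xi>' \<omega>') t)"

(* Minimizers need not be unique, so an estimator is modelled as the set of its possible
   estimates, given the time, the initial guess and the input and output data. *)
definition fie_estimates ::
  "(real^'n \<Rightarrow> real^'m \<Rightarrow> real^'q \<Rightarrow> real^'n) \<Rightarrow> (real^'n \<Rightarrow> real^'m \<Rightarrow> real^'q \<Rightarrow> real^'p) \<Rightarrow>
   (real^'n) set \<Rightarrow> (real^'q) set \<Rightarrow> (real^'p) set \<Rightarrow>
   (real \<Rightarrow> real) \<Rightarrow> (real \<Rightarrow> real) \<Rightarrow> (real \<Rightarrow> real) \<Rightarrow> real \<Rightarrow>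
   nat \<Rightarrow> real^'n \<Rightarrow> (nat \<Rightarrow> real^'m) \<Rightarrow> (nat \<Rightarrow> real^'p) \<Rightarrow> (real^'n) set" where
  "fie_estimates f h X W Y \<alpha>2 \<sigma>w \<sigma>y \<eta> t xhat0 u y =
     {state_traj f u \<xi> \<omega> t | \<xi> \<omega>. fie_minimizer f h X W Y \<alpha>2 \<sigma>w \<sigma>y \<eta> t xhat0 u y \<xi> \<omega>}"

lemma fie_estimates_0:
  fixes h :: "real^'n \<Rightarrow> real^'m \<Rightarrow> real^'q \<Rightarrow> real^'p"
  assumes "class_K \<alpha>2" "xhat0 \<in> X"
  shows "fie_estimates f h X W Y \<alpha>2 \<sigma>w \<sigma>y \<eta> 0 xhat0 u y = {xhat0}"
proof -
  have pos: "0 \<le> \<alpha>2 (2 * norm (x - xhat0))" for x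
    using assms(1) by (auto simp: class_K_def)
  have zero: "x = xhat0" if "\<alpha>2 (2 * norm (x - xhat0)) \<le> \<alpha>2 0" for x
  proof (rule ccontr)
    assume "x \<noteq> xhat0"
    then have "\<alpha>2 0 < \<alpha>2 (2 * norm (x - xhat0))"
      using assms(1) strict_mono_onD[of "{0..}" \<alpha>2 0 "2 * norm (x - xhat0)"]
      by (simp add: class_K_def)
    with that show False by simp
  qed
  have "\<alpha>2 0 = 0" using assms(1) by (simp add: class_K_def)
  then show ?thesis
    using assms(2) pos zero
    by (fastforce simp: fie_estimates_def fie_minimizer_def fie_feasible_def fie_cost_def)
qed

(* Inserting 0 implements the convention that the maximum over an empty index set is 0. *)
definition RGAS ::
  "(real^'n \<Rightarrow> real^'m \<Rightarrow> real^'q \<Rightarrow> real^'n) \<Rightarrow> (real^'n \<Rightarrow> real^'m \<Rightarrow> real^'q \<Rightarrow> real^'p) \<Rightarrow>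
   (real^'n) set \<Rightarrow> (real^'m) set \<Rightarrow> (real^'q) set \<Rightarrow> (real^'p) set \<Rightarrow>
   (nat \<Rightarrow> real^'n \<Rightarrow> (nat \<Rightarrow> real^'m) \<Rightarrow> (nat \<Rightarrow> real^'p) \<Rightarrow> (real^'n) set) \<Rightarrow> bool" where
  "RGAS f h X U W Y estimates \<longleftrightarrow>
     (\<exists>\<beta>1 \<beta>2. class_KL \<beta>1 \<and> class_KL \<beta>2 \<and>
        (\<forall>x u w y xhat0. admissible_trajectory f h X U W Y x u w y \<and> xhat0 \<in> X \<longrightarrow>
           (\<forall>t. \<forall>xhat \<in> estimates t xhat0 u y.
              norm (x t - xhat) \<le>
                max (\<beta>1 (norm (x 0 - xhat0)) t)
                    (Max (insert 0 ((\<lambda>j. \<beta>2 (norm (w j)) (t - j - 1)) ` {..<t}))))))"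

end

theory Submission
  imports Defs
begin

text \<open>Along an optimal estimated trajectory the Lyapunov inequality discounts to a bound on
  \<open>\<alpha>1 (norm (x t - xhat))\<close>.  Splitting \<open>\<alpha>2\<close> and \<open>\<sigma>w\<close> at twice their arguments bounds this by
  the optimal cost plus the cost of the true trajectory, and hence, by optimality, by twice the
  latter.  With \<open>\<mu> = (1 + \<eta>) / 2\<close> one has \<open>\<eta> \<le> \<mu>\<^sup>2\<close>: one factor \<open>\<mu>\<close> turns the discounted
  sum into a maximum, the other provides the decay of the KL functions.\<close>

section \<open>Comparison functions\<close>

lemma class_K_nonneg: "class_K \<alpha> \<Longrightarrow> 0 \<le> r \<Longrightarrow> 0 \<le> \<alpha> r"
  by (auto simp: class_K_def)

lemma class_K_zero: "class_K \<alpha> \<Longrightarrow> \<alpha> 0 = 0"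
  by (simp add: class_K_def)

lemma class_K_less: "class_K \<alpha> \<Longrightarrow> 0 \<le> r \<Longrightarrow> r < s \<Longrightarrow> \<alpha> r < \<alpha> s"
  by (auto simp: class_K_def intro: strict_mono_onD)

lemma class_K_le_iff: "class_K \<alpha> \<Longrightarrow> 0 \<le> r \<Longrightarrow> 0 \<le> s \<Longrightarrow> \<alpha> r \<le> \<alpha> s \<longleftrightarrow> r \<le> s"
  by (metis class_K_less leD linorder_le_less_linear order_le_less)

text \<open>A class K function need not be subadditive, but \<open>c\<close> is at most twice the
  larger of \<open>a\<close> and \<open>b\<close>, and the larger of two nonnegative values is at
  most their sum. This is where the factors 2 inside \<open>fie_cost\<close> come from.\<close>

lemma class_K_add_le:
  assumes "class_K \<alpha>" "0 \<le> a" "0 \<le> b" "0 \<le> c" "c \<le> a + b"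
  shows "\<alpha> c \<le> \<alpha> (2 * a) + \<alpha> (2 * b)"
proof -
  have "\<alpha> c \<le> \<alpha> (2 * max a b)"
    using assms by (subst class_K_le_iff) auto
  also have "\<dots> \<le> \<alpha> (2 * a) + \<alpha> (2 * b)"
    using class_K_nonneg[OF assms(1), of "2 * a"] class_K_nonneg[OF assms(1), of "2 * b"] assms(2,3)
    by (auto simp: max_def)
  finally show ?thesis .
qed

lemma class_K_inf_image:
  assumes "class_K_inf \<alpha>"
  shows "\<alpha> ` {0..} = {0..}"
proof
  show "\<alpha> ` {0..} \<subseteq> {0..}"
    using assms by (auto simp: class_K_inf_def class_K_def)
  show "{0..} \<subseteq> \<alpha> ` {0..}"
  proof
    fix y :: real assume y: "y \<in> {0..}"
    have "\<not> (\<forall>r\<in>\<alpha> ` {0..}. r \<le> y)"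
      using assms by (auto simp: class_K_inf_def bdd_above_def)
    then obtain b where b: "0 \<le> b" "y \<le> \<alpha> b"
      by force
    have "continuous_on {0..b} \<alpha>" "\<alpha> 0 = 0"
      using assms by (auto simp: class_K_inf_def class_K_def intro: continuous_on_subset)
    then show "y \<in> \<alpha> ` {0..}"
      using IVT'[of \<alpha> 0 y b] b y by auto
  qed
qed

text \<open>Unboundedness makes \<open>\<alpha>\<close> onto the nonnegative reals, and a continuous
  injection on an interval is a homeomorphism onto its image. The inverse of
  \<open>\<alpha>1\<close> will convert bounds on \<open>\<alpha>1\<close> of the error into bounds
  on the error.\<close>

lemma class_K_inf_inverse:
  assumes "class_K_inf \<alpha>"
  obtains g where "class_K g" "\<And>y. 0 \<le> y \<Longrightarrow> \<alpha> (g y) = y"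
proof -
  have K: "class_K \<alpha>" using assms by (simp add: class_K_inf_def)
  have "inj_on \<alpha> {0..}"
    using K by (auto simp: class_K_def intro: strict_mono_on_imp_inj_on)
  moreover have "continuous_on {0..} \<alpha>" using K by (simp add: class_K_def)
  ultimately obtain g where g: "homeomorphism {0..} {0..} \<alpha> g"
    using injective_into_1d_eq_homeomorphism[of "{0..}" \<alpha>] class_K_inf_image[OF assms]
    by (auto simp: is_interval_path_connected_1 is_interval_ci)
  have inv: "\<alpha> (g y) = y" "0 \<le> g y" if "0 \<le> y" for y
    using g that by (auto simp: homeomorphism_def)
  have "class_K g"
    unfolding class_K_def
  proof (intro conjI)
    show "strict_mono_on {0..} g"
    proof (rule strict_mono_onI)
      fix r s :: real assume "r \<in> {0..}" "s \<in> {0..}" "r < s"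
      then show "g r < g s"
        using inv[of r] inv[of s] class_K_le_iff[OF K, of "g s" "g r"] by fastforce
    qed
    show "g 0 = 0"
      using homeomorphism_apply1[OF g, of 0] class_K_zero[OF K] by simp
  qed (use g inv in \<open>auto simp: homeomorphism_def\<close>)
  then show thesis using inv that by blast
qed

text \<open>Common shape of both functions that witness \<open>RGAS\<close>. The ratio has to be
  positive: powers of \<open>\<eta>\<close> would not do, since for \<open>\<eta> = 0\<close> they
  vanish at positive times and strict monotonicity in \<open>r\<close> is lost.\<close>

lemma class_KL_geometric:
  assumes g: "class_K g" and a: "class_K a" and c: "0 < c" and \<mu>: "0 < \<mu>" "\<mu> < 1"
  shows "class_KL (\<lambda>r t. g (c * \<mu> ^ t * a (2 * r)))"
  unfolding class_KL_def
proof (intro conjI allI impI)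
  have nn: "0 \<le> c * \<mu> ^ t * a (2 * r)" if "0 \<le> r" for r t
    using that c \<mu> class_K_nonneg[OF a] by simp
  {
    fix t
    show "class_K (\<lambda>r. g (c * \<mu> ^ t * a (2 * r)))"
      unfolding class_K_def
    proof (intro conjI)
      have a2: "continuous_on {0..} (\<lambda>r. a (2 * r))"
        by (rule continuous_on_compose2[of "{0..}" a])
          (use a in \<open>auto simp: class_K_def intro!: continuous_intros\<close>)
      show "continuous_on {0..} (\<lambda>r. g (c * \<mu> ^ t * a (2 * r)))"
        by (rule continuous_on_compose2[where g = g and t = "{0..}"])
          (use g nn a2 in \<open>auto simp: class_K_def intro!: continuous_intros\<close>)
      show "strict_mono_on {0..} (\<lambda>r. g (c * \<mu> ^ t * a (2 * r)))"
        by (rule strict_mono_onI, rule class_K_less[OF g])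
          (use nn c \<mu> class_K_less[OF a] in \<open>auto intro!: mult_strict_left_mono\<close>)
    qed (use g a nn in \<open>auto simp: class_K_zero class_K_nonneg\<close>)
  }
  fix r :: real assume r: "0 \<le> r"
  show "class_L (\<lambda>t. g (c * \<mu> ^ t * a (2 * r)))"
    unfolding class_L_def
  proof (intro conjI allI)
    show "antimono (\<lambda>t. g (c * \<mu> ^ t * a (2 * r)))"
      using r c \<mu> nn class_K_nonneg[OF a, of "2 * r"]
      by (auto simp: monotone_def class_K_le_iff[OF g] intro!: mult_right_mono mult_left_mono power_decreasing)
    have "(\<lambda>t. c * \<mu> ^ t * a (2 * r)) \<longlonglongrightarrow> c * 0 * a (2 * r)"
      using \<mu> by (intro tendsto_intros LIMSEQ_power_zero) auto
    then have lim: "(\<lambda>t. c * \<mu> ^ t * a (2 * r)) \<longlonglongrightarrow> 0"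
      by simp
    have "continuous_on {0..} g"
      using g by (simp add: class_K_def)
    from continuous_on_tendsto_compose[OF this lim]
    have "(\<lambda>t. g (c * \<mu> ^ t * a (2 * r))) \<longlonglongrightarrow> g 0"
      using nn[OF r] by simp
    then show "(\<lambda>t. g (c * \<mu> ^ t * a (2 * r))) \<longlonglongrightarrow> 0"
      using class_K_zero[OF g] by simp
  qed (use nn[OF r] class_K_nonneg[OF g] in auto)
qed

section \<open>Discounted sums\<close>

lemma discounted_sum_Suc:
  fixes \<eta> :: real
  shows "(\<Sum>j=1..Suc t. \<eta> ^ (j - 1) * F (Suc t - j)) = \<eta> * (\<Sum>j=1..t. \<eta> ^ (j - 1) * F (t - j)) + F t"
proof -
  have "(\<Sum>j=1..Suc t. \<eta> ^ (j - 1) * F (Suc t - j)) = (\<Sum>j=0..t. \<eta> ^ j * F (t - j))"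
    using sum.shift_bounds_cl_Suc_ivl[of "\<lambda>j. \<eta> ^ (j - 1) * F (Suc t - j)" 0 t] by simp
  also have "\<dots> = F t + (\<Sum>j=1..t. \<eta> ^ j * F (t - j))"
    by (simp add: sum.atLeast_Suc_atMost)
  also have "(\<Sum>j=1..t. \<eta> ^ j * F (t - j)) = \<eta> * (\<Sum>j=1..t. \<eta> ^ (j - 1) * F (t - j))"
    unfolding sum_distrib_left
    by (rule sum.cong) (auto simp: mult.assoc[symmetric] power_Suc[symmetric] simp del: power_Suc)
  finally show ?thesis by simp
qed

text \<open>A discrete Gronwall inequality. The index \<open>j\<close> counts backwards from
  \<open>t\<close>, so the latest term \<open>F (t - 1)\<close> has weight 1, exactly as in
  \<open>fie_cost\<close>.\<close>

lemma discounted_recursion_bound: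
  fixes v :: "nat \<Rightarrow> real"
  assumes "0 \<le> \<eta>" "\<And>i. i < t \<Longrightarrow> v (Suc i) \<le> \<eta> * v i + F i"
  shows "v t \<le> \<eta> ^ t * v 0 + (\<Sum>j=1..t. \<eta> ^ (j - 1) * F (t - j))"
  using assms(2)
proof (induction t)
  case (Suc t)
  have "v (Suc t) \<le> \<eta> * v t + F t" using Suc.prems by simp
  also have "\<dots> \<le> \<eta> * (\<eta> ^ t * v 0 + (\<Sum>j=1..t. \<eta> ^ (j - 1) * F (t - j))) + F t"
    using Suc assms(1) by (simp add: mult_left_mono)
  finally show ?case unfolding discounted_sum_Suc by (simp add: algebra_simps)
qed simp

text \<open>Any upper bound \<open>M\<close> of the \<open>\<mu>\<close>-discounted values stands in
  for their maximum. What remains is a geometric series, bounded by \<open>1 / (1 - \<mu>)\<close>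
  uniformly in \<open>t\<close>.\<close>

lemma discounted_sum_le_bound:
  fixes \<mu> :: real
  assumes "0 \<le> \<eta>" "\<eta> \<le> \<mu> * \<mu>" "0 < \<mu>" "\<mu> < 1" "0 \<le> M"
    and s: "\<And>j. j < t \<Longrightarrow> 0 \<le> s j" "\<And>j. j < t \<Longrightarrow> \<mu> ^ (t - j - 1) * s j \<le> M"
  shows "(\<Sum>j=1..t. \<eta> ^ (j - 1) * s (t - j)) \<le> M / (1 - \<mu>)"
proof -
  have "(\<Sum>j=1..t. \<eta> ^ (j - 1) * s (t - j)) \<le> (\<Sum>j=1..t. \<mu> ^ (j - 1) * M)"
  proof (rule sum_mono)
    fix j assume j: "j \<in> {1..t}"
    have "\<eta> ^ (j - 1) \<le> \<mu> ^ (j - 1) * \<mu> ^ (j - 1)"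
      using power_mono[OF assms(2,1)] by (simp add: power_mult_distrib)
    then have "\<eta> ^ (j - 1) * s (t - j) \<le> \<mu> ^ (j - 1) * (\<mu> ^ (j - 1) * s (t - j))"
      using s(1)[of "t - j"] j by (simp add: mult_right_mono mult.assoc[symmetric])
    also have "\<dots> \<le> \<mu> ^ (j - 1) * M"
    proof -
      \<comment> \<open>The entry at time \<open>t - j\<close> has age \<open>j - 1\<close>; the
        truncated subtraction is harmless because \<open>j\<close> lies between 1 and
        \<open>t\<close>.\<close>
      have "t - (t - j) - 1 = j - 1" using j by auto
      then show ?thesis using s(2)[of "t - j"] j assms(3) by (intro mult_left_mono) auto
    qed
    finally show "\<eta> ^ (j - 1) * s (t - j) \<le> \<mu> ^ (j - 1) * M" .
  qed
  also have "\<dots> = (\<Sum>j<t. \<mu> ^ j) * M"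
    unfolding sum_distrib_right by (rule sum.reindex_bij_witness[of _ Suc "\<lambda>j. j - 1"]) auto
  also have "\<dots> = (1 - \<mu> ^ t) / (1 - \<mu>) * M"
    using assms(4) by (simp add: sum_gp_strict)
  also have "\<dots> \<le> 1 / (1 - \<mu>) * M"
    using assms by (intro mult_right_mono divide_right_mono) auto
  finally show ?thesis by simp
qed

section \<open>Error bound for the estimator\<close>

lemma state_traj_admissible:
  assumes "admissible_trajectory f h X U W Y x u w y"
  shows "state_traj f u (x 0) w t = x t"
  by (induction t) (use assms in \<open>auto simp: admissible_trajectory_def\<close>)

lemma fie_error_bound:
  fixes f :: "real^'n \<Rightarrow> real^'m \<Rightarrow> real^'q \<Rightarrow> real^'n"
    and h :: "real^'n \<Rightarrow> real^'m \<Rightarrow> real^'q \<Rightarrow> real^'p"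
  assumes L: "delta_IOSS_Lyapunov f h X U W Y V \<alpha>1 \<alpha>2 \<sigma>w \<sigma>y \<eta>"
    and adm: "admissible_trajectory f h X U W Y x u w y"
    and est: "xhat \<in> fie_estimates f h X W Y \<alpha>2 \<sigma>w \<sigma>y \<eta> t xhat0 u y"
  shows "\<alpha>1 (norm (x t - xhat)) \<le>
    2 * (\<eta> ^ t * \<alpha>2 (2 * norm (x 0 - xhat0)) + (\<Sum>j=1..t. \<eta> ^ (j - 1) * \<sigma>w (2 * norm (w (t - j)))))"
proof -
  have K: "class_K \<alpha>2" "class_K \<sigma>w" "class_K \<sigma>y" and \<eta>: "0 \<le> \<eta>"
    using L by (auto simp: delta_IOSS_Lyapunov_def class_K_inf_def)
  \<comment> \<open>The true trajectory supplies the input, disturbance and output needed to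
    instantiate the definition. No output of \<open>a\<close> or \<open>b\<close> is involved, so
    the bound also applies to the final estimated state, where no output constraint is
    imposed.\<close>
  have bounds: "\<alpha>1 (norm (a - b)) \<le> V a b \<and> V a b \<le> \<alpha>2 (norm (a - b))" if "a \<in> X" "b \<in> X" for a b
    using L adm that unfolding delta_IOSS_Lyapunov_def admissible_trajectory_def by blast
  have diss: "V (f a u' v) (f b u' v') \<le> \<eta> * V a b + (\<sigma>w (norm (v - v')) + \<sigma>y (norm (h b u' v' - h a u' v)))"
    if "a \<in> X" "b \<in> X" "u' \<in> U" "v \<in> W" "v' \<in> W" "h a u' v \<in> Y" "h b u' v' \<in> Y" for a b u' v v'
    using L that unfolding delta_IOSS_Lyapunov_def by (force simp: norm_minus_commute)
  have true: "x (Suc j) = f (x j) (u j) (w j)" "y j = h (x j) (u j) (w j)"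
    "x j \<in> X" "u j \<in> U" "w j \<in> W" "y j \<in> Y" for j
    using adm[unfolded admissible_trajectory_def, rule_format, of j] by auto
  obtain \<xi> \<omega> where xhat: "xhat = state_traj f u \<xi> \<omega> t"
    and min: "fie_minimizer f h X W Y \<alpha>2 \<sigma>w \<sigma>y \<eta> t xhat0 u y \<xi> \<omega>"
    using est by (auto simp: fie_estimates_def)
  define z where "z = state_traj f u \<xi> \<omega>"
  define \<upsilon> where "\<upsilon> = output_traj f h u \<xi> \<omega>"
  have z: "z 0 = \<xi>" "z (Suc j) = f (z j) (u j) (\<omega> j)" "\<upsilon> j = h (z j) (u j) (\<omega> j)" for j
    by (auto simp: z_def \<upsilon>_def output_traj_def)
  have feas: "j \<le> t \<Longrightarrow> z j \<in> X" "j < t \<Longrightarrow> \<omega> j \<in> W" "j < t \<Longrightarrow> \<upsilon> j \<in> Y" for j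
    using min by (auto simp: fie_minimizer_def fie_feasible_def z_def \<upsilon>_def)
  let ?cost = "fie_cost \<alpha>2 \<sigma>w \<sigma>y \<eta> xhat0 y"
  let ?S = "\<Sum>j=1..t. \<eta> ^ (j - 1) * \<sigma>w (2 * norm (w (t - j)))"
  have out: "output_traj f h u (x 0) w = y"
    using true(2) by (auto simp: output_traj_def state_traj_admissible[OF adm])
  \<comment> \<open>The true trajectory is a competitor in the minimization, and its output
    residuals are zero, so its cost has no \<open>\<sigma>y\<close> part.\<close>
  then have "fie_feasible f h X W Y u t (x 0) w"
    using true by (auto simp: fie_feasible_def state_traj_admissible[OF adm])
  then have "?cost \<xi> \<omega> \<upsilon> t \<le> ?cost (x 0) w y t"
    using min out unfolding fie_minimizer_def \<upsilon>_def by metis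
  also have "?cost (x 0) w y t = \<eta> ^ t * \<alpha>2 (2 * norm (x 0 - xhat0)) + ?S"
    using K by (simp add: fie_cost_def class_K_zero)
  finally have opt: "?cost \<xi> \<omega> \<upsilon> t \<le> \<eta> ^ t * \<alpha>2 (2 * norm (x 0 - xhat0)) + ?S" .
  have "\<alpha>1 (norm (x t - z t)) \<le> V (x t) (z t)"
    using bounds feas true by simp
  also have "\<dots> \<le> \<eta> ^ t * V (x 0) (z 0) +
      (\<Sum>j=1..t. \<eta> ^ (j - 1) * (\<sigma>w (norm (w (t - j) - \<omega> (t - j))) + \<sigma>y (norm (\<upsilon> (t - j) - y (t - j)))))"
  proof (rule discounted_recursion_bound[where v = "\<lambda>i. V (x i) (z i)", OF \<eta>])
    fix i assume "i < t"
    then show "V (x (Suc i)) (z (Suc i)) \<le>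
        \<eta> * V (x i) (z i) + (\<sigma>w (norm (w i - \<omega> i)) + \<sigma>y (norm (\<upsilon> i - y i)))"
      using diss[of "x i" "z i" "u i" "w i" "\<omega> i"] true feas z by (metis less_imp_le)
  qed
  \<comment> \<open>The initial error is split at the guess \<open>xhat0\<close> and each
    disturbance difference at 0. The output residuals stay whole, since they already occur in this
    form in the cost.\<close>
  also have "\<dots> \<le> \<eta> ^ t * (\<alpha>2 (2 * norm (x 0 - xhat0)) + \<alpha>2 (2 * norm (\<xi> - xhat0))) +
      (\<Sum>j=1..t. \<eta> ^ (j - 1) * (\<sigma>w (2 * norm (w (t - j))) + \<sigma>w (2 * norm (\<omega> (t - j))) +
         \<sigma>y (norm (\<upsilon> (t - j) - y (t - j)))))"
  proof (intro add_mono mult_left_mono sum_mono)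
    have "V (x 0) (z 0) \<le> \<alpha>2 (norm (x 0 - \<xi>))"
      using bounds true feas z by (metis le0)
    also have "\<dots> \<le> \<alpha>2 (2 * norm (x 0 - xhat0)) + \<alpha>2 (2 * norm (\<xi> - xhat0))"
      by (rule class_K_add_le[OF K(1)]) (use norm_triangle_ineq4[of "x 0 - xhat0" "\<xi> - xhat0"] in auto)
    finally show "V (x 0) (z 0) \<le> \<alpha>2 (2 * norm (x 0 - xhat0)) + \<alpha>2 (2 * norm (\<xi> - xhat0))" .
    show "\<sigma>w (norm (w (t - j) - \<omega> (t - j))) \<le> \<sigma>w (2 * norm (w (t - j))) + \<sigma>w (2 * norm (\<omega> (t - j)))" for j
      by (rule class_K_add_le[OF K(2)]) (auto intro: norm_triangle_ineq4)
  qed (use \<eta> in auto)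
  \<comment> \<open>All terms in \<open>\<xi>\<close>, \<open>\<omega>\<close> and
    \<open>\<upsilon>\<close> together are the optimal cost.\<close>
  also have "\<dots> = \<eta> ^ t * \<alpha>2 (2 * norm (x 0 - xhat0)) + ?S + ?cost \<xi> \<omega> \<upsilon> t"
    by (simp add: fie_cost_def sum.distrib[symmetric] algebra_simps)
  also have "\<dots> \<le> 2 * (\<eta> ^ t * \<alpha>2 (2 * norm (x 0 - xhat0)) + ?S)"
    using opt by simp
  finally show ?thesis by (simp add: xhat z_def)
qed

section \<open>From the error bound to the RGAS estimate\<close>

theorem corollary2:
  fixes f :: "real^'n \<Rightarrow> real^'m \<Rightarrow> real^'q \<Rightarrow> real^'n"
    and h :: "real^'n \<Rightarrow> real^'m \<Rightarrow> real^'q \<Rightarrow> real^'p"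
    and X :: "(real^'n) set" and U :: "(real^'m) set"
    and W :: "(real^'q) set" and Y :: "(real^'p) set"
    and W\<delta> :: "real^'n \<Rightarrow> real^'n \<Rightarrow> real"
    and \<alpha>1 \<alpha>2 \<sigma>w \<sigma>y :: "real \<Rightarrow> real" and \<eta> :: real
  assumes "continuous_on UNIV (\<lambda>(x, u, w). f x u w)"
    and "continuous_on UNIV (\<lambda>(x, u, w). h x u w)"
    and "delta_IOSS_Lyapunov f h X U W Y W\<delta> \<alpha>1 \<alpha>2 \<sigma>w \<sigma>y \<eta>"
  shows "RGAS f h X U W Y (fie_estimates f h X W Y \<alpha>2 \<sigma>w \<sigma>y \<eta>)"
proof -
  note L = assms(3)
  have K: "class_K_inf \<alpha>1" "class_K \<alpha>1" "class_K \<alpha>2" "class_K \<sigma>w" and \<eta>: "0 \<le> \<eta>" "\<eta> < 1"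
    using L by (auto simp: delta_IOSS_Lyapunov_def class_K_inf_def)
  obtain g where g: "class_K g" and inv: "\<And>r. 0 \<le> r \<Longrightarrow> \<alpha>1 (g r) = r"
    using class_K_inf_inverse[OF K(1)] by blast
  \<comment> \<open>The arithmetic mean of 1 and \<open>\<eta>\<close> dominates their geometric
    mean, so its square is at least \<open>\<eta>\<close>; it stays positive even for
    \<open>\<eta> = 0\<close>.\<close>
  define \<mu> where "\<mu> = (1 + \<eta>) / 2"
  have \<mu>: "0 < \<mu>" "\<mu> < 1" "\<eta> \<le> \<mu>" using \<eta> by (auto simp: \<mu>_def)
  have "\<mu> * \<mu> - \<eta> = ((1 - \<eta>) / 2)\<^sup>2"
    by (simp add: \<mu>_def power2_eq_square field_simps)
  then have \<mu>2: "\<eta> \<le> \<mu> * \<mu>"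
    by (metis diff_ge_0_iff_ge zero_le_power2)
  \<comment> \<open>The 4 combines the factor 2 of \<open>fie_error_bound\<close> with the passage
    from a sum of two terms to a maximum. The extra \<open>1 / (1 - \<mu>)\<close> in
    \<open>\<beta>2\<close> pays for the geometric series.\<close>
  define \<beta>1 where "\<beta>1 = (\<lambda>r t. g (4 * \<mu> ^ t * \<alpha>2 (2 * r)))"
  define \<beta>2 where "\<beta>2 = (\<lambda>r t. g (4 / (1 - \<mu>) * \<mu> ^ t * \<sigma>w (2 * r)))"
  have KL: "class_KL \<beta>1" "class_KL \<beta>2"
    unfolding \<beta>1_def \<beta>2_def using \<mu> by (intro class_KL_geometric g K; simp)+
  have "norm (x t - xhat) \<le> max (\<beta>1 (norm (x 0 - xhat0)) t)
          (Max (insert 0 ((\<lambda>j. \<beta>2 (norm (w j)) (t - j - 1)) ` {..<t})))" (is "_ \<le> ?B")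
    if adm: "admissible_trajectory f h X U W Y x u w y"
      and est: "xhat \<in> fie_estimates f h X W Y \<alpha>2 \<sigma>w \<sigma>y \<eta> t xhat0 u y"
    for x u w y xhat0 t xhat
  proof -
    \<comment> \<open>The inserted 0 makes the bound nonnegative, so that \<open>\<alpha>1\<close>
      is monotone there.\<close>
    have B: "0 \<le> ?B" by (intro max.coboundedI2 Max_ge) auto
    have le_B: "c \<le> \<alpha>1 ?B" if "0 \<le> c" "g c \<le> ?B" for c
      using that inv[of c] class_K_le_iff[OF K(2), of "g c" ?B] class_K_nonneg[OF g, of c] B by metis
    have init: "4 * \<mu> ^ t * \<alpha>2 (2 * norm (x 0 - xhat0)) \<le> \<alpha>1 ?B"
      using \<mu> class_K_nonneg[OF K(3)] by (intro le_B) (auto simp: \<beta>1_def)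
    have dist: "4 / (1 - \<mu>) * \<mu> ^ (t - j - 1) * \<sigma>w (2 * norm (w j)) \<le> \<alpha>1 ?B" if "j < t" for j
    proof (rule le_B)
      show "0 \<le> 4 / (1 - \<mu>) * \<mu> ^ (t - j - 1) * \<sigma>w (2 * norm (w j))"
        using \<mu> class_K_nonneg[OF K(4)] by simp
      show "g (4 / (1 - \<mu>) * \<mu> ^ (t - j - 1) * \<sigma>w (2 * norm (w j))) \<le> ?B"
        using that by (intro max.coboundedI2 Max_ge) (auto simp: \<beta>2_def)
    qed
    have "\<eta> ^ t * \<alpha>2 (2 * norm (x 0 - xhat0)) \<le> \<mu> ^ t * \<alpha>2 (2 * norm (x 0 - xhat0))"
      using \<eta> \<mu> class_K_nonneg[OF K(3)] by (intro mult_right_mono power_mono) auto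
    with init have 1: "\<eta> ^ t * \<alpha>2 (2 * norm (x 0 - xhat0)) \<le> \<alpha>1 ?B / 4"
      by simp
    \<comment> \<open>Here \<open>M\<close> is chosen so that division by \<open>1 - \<mu>\<close>
      leaves a quarter of \<open>\<alpha>1 ?B\<close>, the same share as the initial error
      receives.\<close>
    have "(\<Sum>j=1..t. \<eta> ^ (j - 1) * \<sigma>w (2 * norm (w (t - j)))) \<le> (1 - \<mu>) * (\<alpha>1 ?B / 4) / (1 - \<mu>)"
    proof (rule discounted_sum_le_bound[where s = "\<lambda>j. \<sigma>w (2 * norm (w j))"])
      show "0 \<le> (1 - \<mu>) * (\<alpha>1 ?B / 4)"
        using \<mu> B class_K_nonneg[OF K(2)] by simp
      show "\<mu> ^ (t - j - 1) * \<sigma>w (2 * norm (w j)) \<le> (1 - \<mu>) * (\<alpha>1 ?B / 4)" if "j < t" for j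
        using dist[OF that] \<mu> by (simp add: field_simps)
    qed (use \<eta> \<mu> \<mu>2 class_K_nonneg[OF K(4)] in auto)
    moreover have "(1 - \<mu>) * a / (1 - \<mu>) = a" for a
      using \<mu> by simp
    ultimately have 2: "(\<Sum>j=1..t. \<eta> ^ (j - 1) * \<sigma>w (2 * norm (w (t - j)))) \<le> \<alpha>1 ?B / 4"
      by metis
    have "c \<le> d" if "a \<le> d / 4" "b \<le> d / 4" "c \<le> 2 * (a + b)" for a b c d :: real
      using that by simp
    from this[OF 1 2 fie_error_bound[OF L adm est]]
    have "\<alpha>1 (norm (x t - xhat)) \<le> \<alpha>1 ?B" .
    then show ?thesis
      using class_K_le_iff[OF K(2)] B by simp
  qed
  with KL show ?thesis unfolding RGAS_def by blast
qed

end
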